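(* Any group that admits $\mathbb{Z}$ as a quotient contains uncountably many robust non-MMCs.
   Context: For subsets $A,B$ of a group $G$, $A\cdot B=\{ab\}$. $A$ is a minimal left (resp. right) complement to $B$ if $A\cdot B=G$ (resp. $B\cdot A=G$) and no proper subset of $A$ has this property. A subset of $G$ is an MMC (minimal multiplicative complement) in $G$ if it is a minimal left or minimal right complement to some nonempty subset of $G$, and a non-MMC otherwise. A subset $C$ of $G$ is a robust non-MMC if every nonempty subset $D$ of $G$ whose symmetric difference with $C$ is finite is a non-MMC in $G$. A group admits $\mathbb{Z}$ as a quotient if there is a surjective homomorphism from it onto $\mathbb{Z}$. *)

theory Defs
  imports "HOL-Algebra.Elementary_Groups" "HOL-Library.Countable_Set"
begin

definition minimal_left_complement ::
    "('a, 'b) monoid_scheme \<Rightarrow> 'a set \<Rightarrow> 'a set \<Rightarrow> bool" where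
  "minimal_left_complement G A B \<longleftrightarrow>
     A \<subseteq> carrier G \<and> B \<subseteq> carrier G \<and>
     A <#>\<^bsub>G\<^esub> B = carrier G \<and>
     (\<forall>A'. A' \<subset> A \<longrightarrow> A' <#>\<^bsub>G\<^esub> B \<noteq> carrier G)"

definition minimal_right_complement ::
    "('a, 'b) monoid_scheme \<Rightarrow> 'a set \<Rightarrow> 'a set \<Rightarrow> bool" where
  "minimal_right_complement G A B \<longleftrightarrow>
     A \<subseteq> carrier G \<and> B \<subseteq> carrier G \<and>
     B <#>\<^bsub>G\<^esub> A = carrier G \<and>
     (\<forall>A'. A' \<subset> A \<longrightarrow> B <#>\<^bsub>G\<^esub> A' \<noteq> carrier G)"

definition MMC :: "('a, 'b) monoid_scheme \<Rightarrow> 'a set \<Rightarrow> bool" where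
  "MMC G A \<longleftrightarrow>
     A \<subseteq> carrier G \<and>
     (\<exists>B. B \<subseteq> carrier G \<and> B \<noteq> {} \<and>
        (minimal_left_complement G A B \<or> minimal_right_complement G A B))"

definition non_MMC :: "('a, 'b) monoid_scheme \<Rightarrow> 'a set \<Rightarrow> bool" where
  "non_MMC G A \<longleftrightarrow> A \<subseteq> carrier G \<and> \<not> MMC G A"

definition robust_non_MMC :: "('a, 'b) monoid_scheme \<Rightarrow> 'a set \<Rightarrow> bool" where
  "robust_non_MMC G C \<longleftrightarrow>
     C \<subseteq> carrier G \<and>
     (\<forall>D. D \<subseteq> carrier G \<and> D \<noteq> {} \<and> finite (sym_diff D C) \<longrightarrow> non_MMC G D)"

end

theory Submission
  imports Defs
begin

text \<open>Let \<open>X\<close> be a set of integers whose gaps tend to infinity, such as a set of powers of two, and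
  pull \<open>{n. 0 \<le> n} - X\<close> back to \<open>G\<close> along a surjection \<open>f\<close> onto the integers. Suppose a finite
  modification \<open>D\<close> of the result is a minimal complement to \<open>B\<close>. Since \<open>f\<close> is bounded below on \<open>D\<close>,
  it is unbounded below on \<open>B\<close>. By minimality every \<open>d \<in> D\<close> has a private element: one which
  is covered by \<open>d\<close> alone. If \<open>c\<close> is its level (its value under \<open>f\<close>), then \<open>c - f b\<close> must lie in \<open>X\<close>
  for every \<open>b \<in> B\<close> with \<open>f b\<close> sufficiently negative. As the gaps of \<open>X\<close> tend to
  infinity, all private elements have the same level \<open>c\<close>. But then any \<open>d \<in> D\<close> with \<open>f d\<close> large
  satisfies \<open>f d = c - f b \<in> X\<close> for some \<open>b \<in> B\<close>, contradicting \<open>d \<in> D\<close>.\<close>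

text \<open>A quantitative form of gaps tending to infinity: above an element x, the next one is at
  least x further on. For x \<le> 0 this is no restriction.\<close>

definition doubling :: "int set \<Rightarrow> bool" where
  "doubling X \<longleftrightarrow> (\<forall>x\<in>X. \<forall>y\<in>X. x < y \<longrightarrow> 2 * x \<le> y)"

text \<open>The exponent set \<open>A\<close> is arbitrary, which supplies uncountably many choices
  of \<open>X\<close>.\<close>

lemma doubling_powers_of_two: "doubling ((\<lambda>n. 2 ^ n) ` A)"
proof -
  have "2 * 2 ^ m \<le> (2::int) ^ n" if "(2::int) ^ m < 2 ^ n" for m n
  proof -
    have "Suc m \<le> n" using that by simp
    then have "(2::int) ^ Suc m \<le> 2 ^ n" by (intro power_increasing) auto
    then show ?thesis by simp
  qed
  then show ?thesis by (auto simp: doubling_def)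
qed

text \<open>Here \<open>h\<close> stands for \<open>f\<close> on \<open>D\<close>, \<open>S\<close> for \<open>f ` B\<close>, and \<open>c d\<close> for the level of a private element
  of \<open>d\<close>; formulated on the level of integers, the argument serves left and right complements alike.\<close>

lemma no_private_levels:
  fixes X S :: "int set" and h c :: "'a \<Rightarrow> int"
  assumes X: "doubling X"
    and S: "\<And>m. \<exists>s\<in>S. s < m"
    and D: "\<And>m. \<exists>d\<in>D. m < h d"
    and notin: "\<And>d. d \<in> D \<Longrightarrow> M \<le> h d \<Longrightarrow> h d \<notin> X"
    and mem: "\<And>d. d \<in> D \<Longrightarrow> c d - h d \<in> S"
    and priv: "\<And>d s. d \<in> D \<Longrightarrow> s \<in> S \<Longrightarrow> M \<le> c d - s \<Longrightarrow> c d - s \<noteq> h d \<Longrightarrow> c d - s \<in> X"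
  shows False
proof -
  have le: "c d' \<le> c d" if d: "d \<in> D" and d': "d' \<in> D" for d d'
  proof (rule ccontr)
    assume "\<not> c d' \<le> c d"
    then have less: "c d < c d'" by simp
    \<comment> \<open>So low an \<open>s\<close> puts both shifted levels above \<open>M\<close> and
      away from \<open>h d\<close> and \<open>h d'\<close>, and makes the lower one larger than the
      gap \<open>c d' - c d\<close>, which \<open>doubling\<close> forbids.\<close>
    obtain s where s: "s \<in> S" "s < c d - (\<bar>M\<bar> + \<bar>h d\<bar> + \<bar>h d'\<bar> + (c d' - c d))"
      using S by blast
    have "c d - s \<in> X" using s less by (intro priv d) auto
    moreover have "c d' - s \<in> X" using s less by (intro priv d') auto
    moreover have "c d - s < c d' - s" using less by simp
    ultimately have "2 * (c d - s) \<le> c d' - s"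
      using X unfolding doubling_def by blast
    then show False using s(2) abs_ge_zero[of M] abs_ge_zero[of "h d"] abs_ge_zero[of "h d'"] by simp
  qed
  obtain d where d: "d \<in> D" using D by blast
  obtain d' where d': "d' \<in> D" "max M (h d) < h d'" using D by blast
  have "c d = c d'" using le d d' by (meson order_antisym)
  \<comment> \<open>As the levels agree, shifting the level of \<open>d\<close> by
    \<open>c d' - h d'\<close> lands on \<open>h d'\<close>, which differs from
    \<open>h d\<close>.\<close>
  then have "h d' \<in> X" using priv[OF d mem[OF d'(1)]] d'(2) by simp
  then show False using notin[of d'] d' by simp
qed

context group
begin

text \<open>Without \<open>d\<close> some \<open>g\<close> is no longer covered, so each
  factorisation of \<open>g\<close> over \<open>D\<close> and \<open>B\<close> has left factor
  \<open>d\<close>.\<close>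

lemma minimal_left_complement_private:
  assumes "minimal_left_complement G D B" and "d \<in> D"
  shows "\<exists>g\<in>carrier G. (\<exists>b\<in>B. g = d \<otimes> b) \<and> (\<forall>b\<in>B. g \<otimes> inv b \<in> D \<longrightarrow> g \<otimes> inv b = d)"
proof -
  have sub: "D \<subseteq> carrier G" "B \<subseteq> carrier G" and cover: "D <#> B = carrier G"
    and "(D - {d}) <#> B \<noteq> carrier G"
    using assms by (auto simp: minimal_left_complement_def)
  moreover have "(D - {d}) <#> B \<subseteq> carrier G"
    using sub by (intro set_mult_closed) auto
  ultimately obtain g where g: "g \<in> carrier G" "g \<notin> (D - {d}) <#> B" by blast
  obtain e b where "e \<in> D" "b \<in> B" "g = e \<otimes> b"
    using g(1) cover unfolding set_mult_def by blast
  then have "\<exists>b\<in>B. g = d \<otimes> b" using g(2) by (auto simp: set_mult_def)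
  moreover have "g \<otimes> inv b = d" if "b \<in> B" "g \<otimes> inv b \<in> D" for b
  proof (rule ccontr)
    assume "g \<otimes> inv b \<noteq> d"
    moreover have "g = (g \<otimes> inv b) \<otimes> b" using that g sub by (simp add: m_assoc subset_iff)
    ultimately show False using that g(2) by (auto simp: set_mult_def)
  qed
  ultimately show ?thesis using g(1) by blast
qed

lemma minimal_right_complement_private:
  assumes "minimal_right_complement G D B" and "d \<in> D"
  shows "\<exists>g\<in>carrier G. (\<exists>b\<in>B. g = b \<otimes> d) \<and> (\<forall>b\<in>B. inv b \<otimes> g \<in> D \<longrightarrow> inv b \<otimes> g = d)"
proof -
  have sub: "D \<subseteq> carrier G" "B \<subseteq> carrier G" and cover: "B <#> D = carrier G"
    and "B <#> (D - {d}) \<noteq> carrier G"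
    using assms by (auto simp: minimal_right_complement_def)
  moreover have "B <#> (D - {d}) \<subseteq> carrier G"
    using sub by (intro set_mult_closed) auto
  ultimately obtain g where g: "g \<in> carrier G" "g \<notin> B <#> (D - {d})" by blast
  obtain e b where "e \<in> D" "b \<in> B" "g = b \<otimes> e"
    using g(1) cover unfolding set_mult_def by blast
  then have "\<exists>b\<in>B. g = b \<otimes> d" using g(2) by (auto simp: set_mult_def)
  moreover have "inv b \<otimes> g = d" if "b \<in> B" "inv b \<otimes> g \<in> D" for b
  proof (rule ccontr)
    assume "inv b \<otimes> g \<noteq> d"
    moreover have "g = b \<otimes> (inv b \<otimes> g)"
      using that g sub by (simp add: m_assoc[symmetric] subset_iff)
    ultimately show False using that g(2) by (auto simp: set_mult_def)
  qed
  ultimately show ?thesis using g(1) by blast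
qed

lemma robust_non_MMC_preimage:
  assumes f: "f \<in> epi G integer_group" and X: "doubling X"
  shows "robust_non_MMC G {g \<in> carrier G. 0 \<le> f g \<and> f g \<notin> X}" (is "robust_non_MMC G ?C")
proof -
  have f_mult: "f (x \<otimes> y) = f x + f y" if "x \<in> carrier G" "y \<in> carrier G" for x y
    using f that by (auto simp: epi_def hom_def)
  have f_surj: "\<exists>g\<in>carrier G. f g = n" for n
    using f by (auto simp: epi_def image_iff) (metis UNIV_I imageE)
  have f_inv: "f (inv x) = - f x" if "x \<in> carrier G" for x
    using f_mult[of "inv x" x] f_mult[of \<one> \<one>] that by simp
  have "\<not> MMC G D" if D: "D \<subseteq> carrier G" and fin: "finite (sym_diff D ?C)" for D
  proof
    assume "MMC G D"
    then obtain B where B: "B \<subseteq> carrier G"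
      and compl: "minimal_left_complement G D B \<or> minimal_right_complement G D B"
      by (auto simp: MMC_def)
    have "finite ((\<lambda>g. \<bar>f g\<bar>) ` sym_diff D ?C)" using fin by simp
    then obtain N where N: "\<And>g. g \<in> sym_diff D ?C \<Longrightarrow> \<bar>f g\<bar> \<le> N"
      by (meson bdd_above_finite bdd_above.E imageI)
    \<comment> \<open>Elements at level \<open>M\<close> or above lie outside the finite
      modification; the summand 2 ensures that \<open>X\<close> contains no two consecutive integers
      from \<open>M\<close> on.\<close>
    define M where "M = \<bar>N\<bar> + 2"
    have D_iff: "g \<in> D \<longleftrightarrow> f g \<notin> X" if "g \<in> carrier G" "M \<le> f g" for g
    proof -
      have "0 \<le> f g" "\<not> \<bar>f g\<bar> \<le> N" using that by (auto simp: M_def)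
      then show ?thesis using N[of g] that by blast
    qed
    have D_below: "- M \<le> f g" if "g \<in> D" for g
      using N[of g] that by (cases "g \<in> ?C") (auto simp: M_def)
    have D_unbounded: "\<exists>d\<in>D. m < f d" for m
    proof -
      define n where "n = \<bar>m\<bar> + M"
      have "n \<notin> X \<or> n + 1 \<notin> X"
      proof (rule ccontr)
        assume "\<not> ?thesis"
        then have "2 * n \<le> n + 1" using X by (simp add: doubling_def)
        then show False by (simp add: n_def M_def)
      qed
      then obtain k where k: "k \<notin> X" "n \<le> k"
        using that[of n] that[of "n + 1"] by auto
      obtain g where g: "g \<in> carrier G" "f g = k" using f_surj by blast
      have "m < k" "M \<le> k" using k(2) by (auto simp: n_def M_def)
      then show ?thesis using D_iff[of g] g k(1) by auto
    qed
    \<comment> \<open>The integers commute, so left and right complements give the same equation of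
      levels.\<close>
    have cover: "\<exists>d\<in>D. \<exists>b\<in>B. f g = f d + f b" if "g \<in> carrier G" for g
    proof -
      have "g \<in> D <#> B \<or> g \<in> B <#> D"
        using that compl by (auto simp: minimal_left_complement_def minimal_right_complement_def)
      then consider d b where "d \<in> D" "b \<in> B" "g = d \<otimes> b" | d b where "d \<in> D" "b \<in> B" "g = b \<otimes> d"
        unfolding set_mult_def by blast
      then show ?thesis
      proof cases
        case 1
        then have "f g = f d + f b" using D B by (simp add: f_mult subset_iff)
        then show ?thesis using 1 by blast
      next
        case 2
        then have "f g = f d + f b" using D B by (simp add: f_mult subset_iff)
        then show ?thesis using 2 by blast
      qed
    qed
    have B_unbounded: "\<exists>s\<in>f ` B. s < m" for m
    proof -
      \<comment> \<open>Since \<open>f d\<close> is at least \<open>- M\<close>, covering level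
        \<open>m - M - 1\<close> forces \<open>f b < m\<close>.\<close>
      obtain g where g: "g \<in> carrier G" "f g = m - M - 1" using f_surj by blast
      obtain d b where "d \<in> D" "b \<in> B" "f g = f d + f b" using cover[OF g(1)] by blast
      then show ?thesis using D_below[of d] g(2) by (intro bexI[of _ "f b"]) auto
    qed
    have "\<exists>c. c - f d \<in> f ` B \<and> (\<forall>s\<in>f ` B. M \<le> c - s \<longrightarrow> c - s \<noteq> f d \<longrightarrow> c - s \<in> X)"
      if d: "d \<in> D" for d
      using compl
    proof
      assume "minimal_left_complement G D B"
      from minimal_left_complement_private[OF this d] obtain g b
        where g: "g \<in> carrier G" "b \<in> B" "g = d \<otimes> b"
          and priv: "\<And>b. b \<in> B \<Longrightarrow> g \<otimes> inv b \<in> D \<Longrightarrow> g \<otimes> inv b = d"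
        by blast
      have "f g - f d = f b" using g(2,3) d D B by (simp add: f_mult subset_iff)
      moreover have "f g - f b' \<in> X" if "b' \<in> B" "M \<le> f g - f b'" "f g - f b' \<noteq> f d" for b'
      proof -
        have b': "b' \<in> carrier G" using that B by blast
        then have eq: "f (g \<otimes> inv b') = f g - f b'" using g(1) by (simp add: f_mult f_inv)
        \<comment> \<open>Its level differs from \<open>f d\<close>, so this element is not
          \<open>d\<close>, and privacy excludes it from \<open>D\<close>. At level \<open>M\<close>
          or above, that means its level is in \<open>X\<close>.\<close>
        then have "g \<otimes> inv b' \<notin> D" using priv[of b'] that by auto
        then show ?thesis using D_iff[of "g \<otimes> inv b'"] eq that(2) g(1) b' by simp
      qed
      ultimately show ?thesis using g by (intro exI[of _ "f g"]) auto
    next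
      assume "minimal_right_complement G D B"
      from minimal_right_complement_private[OF this d] obtain g b
        where g: "g \<in> carrier G" "b \<in> B" "g = b \<otimes> d"
          and priv: "\<And>b. b \<in> B \<Longrightarrow> inv b \<otimes> g \<in> D \<Longrightarrow> inv b \<otimes> g = d"
        by blast
      have "f g - f d = f b" using g(2,3) d D B by (simp add: f_mult subset_iff)
      moreover have "f g - f b' \<in> X" if "b' \<in> B" "M \<le> f g - f b'" "f g - f b' \<noteq> f d" for b'
      proof -
        have b': "b' \<in> carrier G" using that B by blast
        then have eq: "f (inv b' \<otimes> g) = f g - f b'" using g(1) by (simp add: f_mult f_inv)
        then have "inv b' \<otimes> g \<notin> D" using priv[of b'] that by auto
        then show ?thesis using D_iff[of "inv b' \<otimes> g"] eq that(2) g(1) b' by simp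
      qed
      ultimately show ?thesis using g by (intro exI[of _ "f g"]) auto
    qed
    then obtain c where c: "\<And>d. d \<in> D \<Longrightarrow> c d - f d \<in> f ` B"
        "\<And>d s. d \<in> D \<Longrightarrow> s \<in> f ` B \<Longrightarrow> M \<le> c d - s \<Longrightarrow> c d - s \<noteq> f d \<Longrightarrow> c d - s \<in> X"
      by metis
    show False
      by (rule no_private_levels[OF X B_unbounded D_unbounded _ c]) (use D D_iff in auto)
  qed
  then show ?thesis by (auto simp: robust_non_MMC_def non_MMC_def)
qed

end

theorem theorem3p4:
  fixes G :: "('a, 'b) monoid_scheme"
  assumes "group G"
    and "\<exists>f. f \<in> epi G integer_group"
  shows "uncountable {C. robust_non_MMC G C}"
proof
  assume countable: "countable {C. robust_non_MMC G C}"
  obtain f where f: "f \<in> epi G integer_group" using assms by blast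
  define C where "C A = {g \<in> carrier G. 0 \<le> f g \<and> f g \<notin> (\<lambda>n. 2 ^ n) ` A}" for A :: "nat set"
  have "\<exists>g\<in>carrier G. f g = 2 ^ n" for n :: nat
    using f by (auto simp: epi_def image_iff) (metis UNIV_I imageE)
  then obtain r where r: "\<And>n. r n \<in> carrier G" "\<And>n. f (r n) = 2 ^ n" by metis
  \<comment> \<open>The element \<open>r n\<close> at level \<open>2 ^ n\<close> tests whether n is
    in \<open>A\<close>, so \<open>A\<close> can be recovered from \<open>C A\<close>.\<close>
  have "n \<in> A \<longleftrightarrow> r n \<notin> C A" for n A
    using r by (auto simp: C_def)
  then have "A = {n. r n \<notin> C A}" for A by blast
  then have inj: "inj C" by (metis injI)
  have "range C \<subseteq> {C. robust_non_MMC G C}"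
    unfolding C_def using group.robust_non_MMC_preimage[OF assms(1) f doubling_powers_of_two] by auto
  then have "countable (range C)" using countable countable_subset by blast
  then have "countable (UNIV :: nat set set)" using inj countable_image_inj_on by blast
  then obtain e :: "nat \<Rightarrow> nat set" where "range e = UNIV"
    by (metis UNIV_not_empty uncountable_def)
  then show False using Cantors_theorem[of "UNIV :: nat set"] by auto
qed

end
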